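(* For each fixed $L>0$, as $r\to1^-$, $$\mathbb V[\mathcal X_L(r\mathbb D)]=\Theta\left(\frac1{1-r}\right).$$ In other words, for fixed $L$ there are positive constants $c_1,c_2$ depending on $L$ such that $c_2\le(1-r)\mathbb V[\mathcal X_L(r\mathbb D)]\le c_1$ as $r\to1^-$ (i.e. for all $r<1$ sufficiently close to $1$).
   Context: $\mathbb D$ is the open unit disk, $r\mathbb D=\{rz:z\in\mathbb D\}$, $m$ is Lebesgue measure. For $L>0$, $\mathcal X_L$ is the determinantal point process in $\mathbb D$ with kernel $\mathbb K_L(z,w)=\frac1{(1-z\bar w)^{L+1}}$ with respect to the measure $d\mu_L(z)=\frac L\pi(1-|z|^2)^{L-1}dm(z)$ on $\mathbb D$; that is, a simple point process whose joint intensities (correlation functions) with respect to $\mu_L$ are $\rho_k(x_1,\dots,x_k)=\det(\mathbb K_L(x_i,x_j))_{1\le i,j\le k}$, $k\ge1$. $\mathcal X_L(D)$ is the number of points of $\mathcal X_L$ in $D$, and $\mathbb V[X]$ is the variance of the random variable $X$. $f(r)=\Theta(h(r))$ as $r\to1^-$ means that $f/h$ is bounded above and below by positive constants for $r$ close to $1$. *)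

theory Defs
  imports
    "HOL-Probability.Probability"
    "HOL-Library.Landau_Symbols"
    "Jordan_Normal_Form.Determinant"
begin

definition num_points :: "('w \<Rightarrow> 'a set) \<Rightarrow> 'a set \<Rightarrow> 'w \<Rightarrow> ennreal" where
  "num_points X B \<omega> = emeasure (count_space UNIV) (X \<omega> \<inter> B)"

text \<open>
  A simple point process on \<open>S\<close> (no multiple points) is encoded as a random locally finite subset
  of \<open>S\<close>, measurable with respect to the sigma-algebra generated by the counting variables.
\<close>

definition simple_point_process ::
    "'w measure \<Rightarrow> 'a::topological_space set \<Rightarrow> ('w \<Rightarrow> 'a set) \<Rightarrow> bool" where
  "simple_point_process M S X \<longleftrightarrow>
     prob_space M \<and>
     (\<forall>\<omega>\<in>space M. X \<omega> \<subseteq> S) \<and>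
     (\<forall>\<omega>\<in>space M. \<forall>C. compact C \<longrightarrow> C \<subseteq> S \<longrightarrow> finite (X \<omega> \<inter> C)) \<and>
     (\<forall>B\<in>sets (restrict_space borel S). num_points X B \<in> borel_measurable M)"

text \<open>
  \<open>\<rho> k\<close> is the \<open>k\<close>-point joint intensity (correlation function) with respect to \<open>\<mu>\<close>; a point
  \<open>(x\<^sub>1, \<dots>, x\<^sub>k)\<close> is a function on the index set \<open>{..<k}\<close>.  For a simple process, the products of
  counts over pairwise disjoint sets, together with vanishing on the diagonals, specify the
  joint intensities.
\<close>

definition joint_intensities ::
    "'w measure \<Rightarrow> 'a measure \<Rightarrow> ('w \<Rightarrow> 'a set) \<Rightarrow> (nat \<Rightarrow> (nat \<Rightarrow> 'a) \<Rightarrow> real) \<Rightarrow> bool" where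
  "joint_intensities M \<mu> X \<rho> \<longleftrightarrow>
     (\<forall>k\<ge>1.
        \<rho> k \<in> borel_measurable (PiM {..<k} (\<lambda>_. \<mu>)) \<and>
        (\<forall>x\<in>space (PiM {..<k} (\<lambda>_. \<mu>)). 0 \<le> \<rho> k x) \<and>
        (\<forall>x\<in>space (PiM {..<k} (\<lambda>_. \<mu>)). \<not> inj_on x {..<k} \<longrightarrow> \<rho> k x = 0) \<and>
        (\<forall>D. (\<forall>i<k. D i \<in> sets \<mu>) \<longrightarrow> disjoint_family_on D {..<k} \<longrightarrow>
           (\<integral>\<^sup>+ \<omega>. (\<Prod>i<k. num_points X (D i) \<omega>) \<partial>M) =
           (\<integral>\<^sup>+ x. ennreal (\<rho> k x) * indicator (PiE {..<k} D) x \<partial>(PiM {..<k} (\<lambda>_. \<mu>)))))"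

definition determinantal_point_process ::
    "'w measure \<Rightarrow> 'a::topological_space measure \<Rightarrow> ('a \<Rightarrow> 'a \<Rightarrow> complex) \<Rightarrow> ('w \<Rightarrow> 'a set) \<Rightarrow> bool"
  where
  "determinantal_point_process M \<mu> K X \<longleftrightarrow>
     simple_point_process M (space \<mu>) X \<and>
     (\<exists>\<rho>. joint_intensities M \<mu> X \<rho> \<and>
        (\<forall>k\<ge>1. \<forall>x\<in>space (PiM {..<k} (\<lambda>_. \<mu>)).
           complex_of_real (\<rho> k x) = Determinant.det (mat k k (\<lambda>(i, j). K (x i) (x j)))))"

definition disk_measure :: "real \<Rightarrow> complex measure" where
  "disk_measure L =
     density (restrict_space lborel (ball 0 1))
       (\<lambda>z. ennreal (L / pi * (1 - (cmod z)\<^sup>2) powr (L - 1)))"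

text \<open>
  The power is the principal branch; since \<open>Re (1 - z * cnj w) > 0\<close> on the disk, it is the
  branch that is holomorphic in \<open>z\<close>, antiholomorphic in \<open>w\<close>, and equal to \<open>1\<close> at \<open>w = 0\<close>.
\<close>

definition disk_kernel :: "real \<Rightarrow> complex \<Rightarrow> complex \<Rightarrow> complex" where
  "disk_kernel L z w = 1 / ((1 - z * cnj w) powr complex_of_real (L + 1))"

definition disk_process :: "real \<Rightarrow> 'w measure \<Rightarrow> ('w \<Rightarrow> complex set) \<Rightarrow> bool" where
  "disk_process L M X \<longleftrightarrow> determinantal_point_process M (disk_measure L) (disk_kernel L) X"

definition count_variance :: "'w measure \<Rightarrow> ('w \<Rightarrow> complex set) \<Rightarrow> real \<Rightarrow> real" where
  "count_variance M X r = prob_space.variance M (\<lambda>\<omega>. real (card (X \<omega> \<inter> ball 0 r)))"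

end

theory Submission
  imports Defs
begin

text \<open>
  Write \<open>s = 1 - r\<close>, let \<open>D\<close> be the disk of radius \<open>r\<close>, and let \<open>N(B)\<close> be the number of points in
  \<open>B\<close>.  For disjoint \<open>A\<close> and \<open>B\<close> the two-point intensity shows that the covariance of \<open>N(A)\<close> and
  \<open>N(B)\<close> is minus the integral of \<open>\<bar>K\<bar>\<^sup>2\<close> over \<open>A \<times> B\<close> (\<open>determinantal_disjoint_correlation\<close>).

  Upper bound.  Since disjoint parts are negatively correlated, cutting \<open>B\<close> into small cells shows
  that the variance of \<open>N(B)\<close> is at most its mean (\<open>second_moment_le_of_negative_correlation\<close>).
  The mean measure has density \<open>L / pi / (1 - \<bar>z\<bar>\<^sup>2)\<^sup>2\<close>, so the mean of \<open>N(D)\<close> is at most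
  \<open>4 * L / s\<close> (\<open>emeasure_disk_intensity_ball\<close>).

  Lower bound.  Let \<open>A\<close> be the annulus between the radii \<open>1 - s\<close> and \<open>1 - s / 2\<close>.  Pairs of points
  of \<open>D\<close> and \<open>A\<close> near the common boundary circle and at distance of order \<open>s\<close> from each other
  already make the integral of \<open>\<bar>K\<bar>\<^sup>2\<close> over \<open>D \<times> A\<close> at least \<open>c / s\<close>, with \<open>c\<close> positive and
  depending only on \<open>L\<close> (\<open>disk_covariance_ge\<close>).  The variance of \<open>N(A)\<close> is
  at most \<open>8 * L / s\<close> by the upper bound, so the Cauchy--Schwarz inequality forces the variance of \<open>N(D)\<close> to be at least
  \<open>(c / s)\<^sup>2 / (8 * L / s) = c\<^sup>2 / (8 * L) / s\<close>.  Neither the reproducing property of the kernel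
  nor an expansion in monomials is needed.
\<close>

section \<open>Counts of a point process with negatively correlated parts\<close>

lemma num_points_eq_card:
  "finite (X \<omega> \<inter> B) \<Longrightarrow> num_points X B \<omega> = ennreal (real (card (X \<omega> \<inter> B)))"
  by (simp add: num_points_def emeasure_count_space_finite ennreal_of_nat_eq_real_of_nat)

lemma countable_separating_opens:
  "\<exists>U :: nat \<Rightarrow> 'a :: {second_countable_topology, t1_space} set.
     (\<forall>i. open (U i)) \<and> (\<forall>x y. x \<noteq> y \<longrightarrow> (\<exists>i. x \<in> U i \<and> y \<notin> U i))"
proof -
  obtain B :: "'a set set" where B: "countable B" "topological_basis B"
    using ex_countable_basis by blast
  have ne: "insert {} B \<noteq> {}" by simp
  define U where "U = from_nat_into (insert {} B)"
  have rng: "range U = insert {} B"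
    unfolding U_def using B(1) by (intro range_from_nat_into) auto
  have "open (U i)" for i
  proof -
    have "U i \<in> insert {} B" using rng by blast
    then show ?thesis using topological_basis_open[OF B(2)] by auto
  qed
  moreover have "\<exists>i. x \<in> U i \<and> y \<notin> U i" if "x \<noteq> y" for x y
  proof -
    obtain V where V: "open V" "x \<in> V" "y \<notin> V" using t1_space \<open>x \<noteq> y\<close> by blast
    obtain W where "W \<in> B" "x \<in> W" "W \<subseteq> V" using topological_basisE[OF B(2) V(1,2)] .
    then show ?thesis using V rng by (metis insertCI rangeE subsetD)
  qed
  ultimately show ?thesis by blast
qed

lemma sum_squared_split_diagonal:
  fixes a :: "'b \<Rightarrow> 'c :: comm_semiring_1"
  assumes "finite P"
  shows "(\<Sum>p\<in>P. a p) ^ 2 = (\<Sum>p\<in>P. (a p) ^ 2) + (\<Sum>p\<in>P. \<Sum>q\<in>P - {p}. a p * a q)"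
proof -
  have "(\<Sum>p\<in>P. a p) ^ 2 = (\<Sum>p\<in>P. \<Sum>q\<in>P. a p * a q)"
    by (simp add: power2_eq_square sum_product)
  also have "\<dots> = (\<Sum>p\<in>P. a p * a p + (\<Sum>q\<in>P - {p}. a p * a q))"
    using assms by (intro sum.cong refl sum.remove) auto
  finally show ?thesis by (simp add: sum.distrib power2_eq_square)
qed

text \<open>
  The conclusion says that the count in \<open>B\<close> has variance at most its mean.  The first \<open>n\<close> sets of a
  sequence of open sets separating points cut \<open>B\<close> into finitely many cells.  The products of counts over distinct cells
  have total expectation at most the squared mean, by hypothesis.  Since the process is simple and
  has finitely many points in \<open>B\<close>, for large \<open>n\<close> every cell contains at most one of them, and then
  the squared count is the count plus the sum of these off-diagonal products; Fatou's lemma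
  concludes.
\<close>

lemma second_moment_le_of_negative_correlation:
  fixes X :: "'w \<Rightarrow> 'a :: {second_countable_topology, t1_space} set"
  assumes X: "simple_point_process M S X"
    and B: "B \<in> sets (restrict_space borel S)"
    and fin: "\<And>\<omega>. \<omega> \<in> space M \<Longrightarrow> finite (X \<omega> \<inter> B)"
    and neg: "\<And>C D. C \<in> sets (restrict_space borel S) \<Longrightarrow> D \<in> sets (restrict_space borel S) \<Longrightarrow>
        C \<inter> D = {} \<Longrightarrow>
        (\<integral>\<^sup>+\<omega>. num_points X C \<omega> * num_points X D \<omega> \<partial>M) \<le>
        (\<integral>\<^sup>+\<omega>. num_points X C \<omega> \<partial>M) * (\<integral>\<^sup>+\<omega>. num_points X D \<omega> \<partial>M)"
  shows "(\<integral>\<^sup>+\<omega>. (num_points X B \<omega>)\<^sup>2 \<partial>M) \<le>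
    (\<integral>\<^sup>+\<omega>. num_points X B \<omega> \<partial>M) + (\<integral>\<^sup>+\<omega>. num_points X B \<omega> \<partial>M)\<^sup>2"
proof -
  obtain U :: "nat \<Rightarrow> 'a set" where U_open: "\<And>i. open (U i)"
    and U_sep: "\<And>x y. x \<noteq> y \<Longrightarrow> \<exists>i. x \<in> U i \<and> y \<notin> U i"
    using countable_separating_opens by metis
  \<comment> \<open>\<open>h n x\<close> labels the cell of \<open>x\<close> in the partition generated by the first \<open>n\<close> open sets\<close>
  define h where "h n x = {i\<in>{..<n}. x \<in> U i}" for n x
  define P :: "nat \<Rightarrow> nat set set" where "P n = Pow {..<n}" for n
  define C where "C n p = {x\<in>B. h n x = p}" for n p
  define N where "N = num_points X"
  define T where "T n \<omega> = (\<Sum>p\<in>P n. \<Sum>q\<in>P n - {p}. N (C n p) \<omega> * N (C n q) \<omega>)" for n \<omega>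
  have finP [simp]: "finite (P n)" for n by (simp add: P_def)
  have hP: "h n x \<in> P n" for n x by (auto simp: h_def P_def)
  have C_sets: "C n p \<in> sets (restrict_space borel S)" for n p
  proof -
    obtain B0 where B0: "B0 \<in> sets borel" "B = S \<inter> B0"
      using B by (auto simp: sets_restrict_space)
    have [measurable]: "U i \<in> sets borel" for i using U_open by simp
    have "{x. h n x = p} = {x\<in>space borel. (\<forall>i<n. x \<in> U i \<longleftrightarrow> i \<in> p) \<and> p \<subseteq> {..<n}}"
      by (auto simp: h_def)
    also have "\<dots> \<in> sets borel" by measurable
    finally have "B0 \<inter> {x. h n x = p} \<in> sets borel" using B0 by blast
    moreover have "C n p = S \<inter> (B0 \<inter> {x. h n x = p})" using B0 by (auto simp: C_def)
    ultimately show ?thesis by (auto simp: sets_restrict_space)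
  qed
  have N_meas: "N D \<in> borel_measurable M" if "D \<in> sets (restrict_space borel S)" for D
    using X that by (simp add: simple_point_process_def N_def)
  note [measurable] = N_meas[OF B] N_meas[OF C_sets]
  have N_sum: "N B \<omega> = (\<Sum>p\<in>P n. N (C n p) \<omega>)" for n \<omega>
  proof -
    have "X \<omega> \<inter> B = (\<Union>p\<in>P n. X \<omega> \<inter> C n p)" using hP by (auto simp: C_def)
    moreover have "disjoint_family_on (\<lambda>p. X \<omega> \<inter> C n p) (P n)"
      by (auto simp: disjoint_family_on_def C_def)
    then have "(\<Sum>p\<in>P n. emeasure (count_space UNIV) (X \<omega> \<inter> C n p)) =
        emeasure (count_space UNIV) (\<Union>p\<in>P n. X \<omega> \<inter> C n p)"
      by (intro sum_emeasure) auto
    ultimately show ?thesis unfolding N_def num_points_def by simp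
  qed
  have ET: "(\<integral>\<^sup>+\<omega>. T n \<omega> \<partial>M) \<le> (\<integral>\<^sup>+\<omega>. N B \<omega> \<partial>M)\<^sup>2" for n
  proof -
    have "(\<integral>\<^sup>+\<omega>. T n \<omega> \<partial>M) =
        (\<Sum>p\<in>P n. \<Sum>q\<in>P n - {p}. \<integral>\<^sup>+\<omega>. N (C n p) \<omega> * N (C n q) \<omega> \<partial>M)"
      unfolding T_def by (simp add: nn_integral_sum)
    also have "\<dots> \<le> (\<Sum>p\<in>P n. \<Sum>q\<in>P n - {p}. (\<integral>\<^sup>+\<omega>. N (C n p) \<omega> \<partial>M) * (\<integral>\<^sup>+\<omega>. N (C n q) \<omega> \<partial>M))"
      unfolding N_def by (intro sum_mono neg C_sets) (auto simp: C_def)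
    also have "\<dots> \<le> (\<Sum>p\<in>P n. \<integral>\<^sup>+\<omega>. N (C n p) \<omega> \<partial>M)\<^sup>2"
      by (subst sum_squared_split_diagonal) auto
    also have "(\<Sum>p\<in>P n. \<integral>\<^sup>+\<omega>. N (C n p) \<omega> \<partial>M) = (\<integral>\<^sup>+\<omega>. N B \<omega> \<partial>M)"
      by (simp add: N_sum[of _ n] nn_integral_sum)
    finally show ?thesis .
  qed
  have T_ev: "\<forall>\<^sub>F n in sequentially. (N B \<omega>)\<^sup>2 = N B \<omega> + T n \<omega>" if \<omega>: "\<omega> \<in> space M" for \<omega>
  proof -
    have "\<forall>\<^sub>F n in sequentially. \<forall>z\<in>(X \<omega> \<inter> B) \<times> (X \<omega> \<inter> B). h n (fst z) = h n (snd z) \<longrightarrow> fst z = snd z"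
    proof (intro eventually_ball_finite ballI)
      show "finite ((X \<omega> \<inter> B) \<times> (X \<omega> \<inter> B))" using fin[OF \<omega>] by simp
      fix z :: "'a \<times> 'a"
      show "\<forall>\<^sub>F n in sequentially. h n (fst z) = h n (snd z) \<longrightarrow> fst z = snd z"
      proof (cases "fst z = snd z")
        case False
        then obtain i where i: "fst z \<in> U i" "snd z \<notin> U i" using U_sep by blast
        then have "h n (fst z) \<noteq> h n (snd z)" if "n > i" for n
          using that by (auto simp: h_def set_eq_iff)
        then show ?thesis by (intro eventually_mono[OF eventually_gt_at_top[of i]]) blast
      qed simp
    qed
    then show ?thesis
    proof eventually_elim
      case (elim n)
      have "(N (C n p) \<omega>)\<^sup>2 = N (C n p) \<omega>" for p
      proof -
        have fc: "finite (X \<omega> \<inter> C n p)"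
          by (rule finite_subset[OF _ fin[OF \<omega>]]) (auto simp: C_def)
        have "card (X \<omega> \<inter> C n p) \<le> Suc 0"
          unfolding card_le_Suc0_iff_eq[OF fc] using elim by (auto simp: C_def)
        then have "card (X \<omega> \<inter> C n p) = 0 \<or> card (X \<omega> \<inter> C n p) = 1" by linarith
        then show ?thesis unfolding N_def num_points_eq_card[of X \<omega>, OF fc] by auto
      qed
      then show ?case
        unfolding N_sum[of \<omega> n] T_def by (subst sum_squared_split_diagonal) simp_all
    qed
  qed
  have "(\<integral>\<^sup>+\<omega>. (N B \<omega>)\<^sup>2 \<partial>M) \<le> (\<integral>\<^sup>+\<omega>. N B \<omega> + liminf (\<lambda>n. T n \<omega>) \<partial>M)"
  proof (rule nn_integral_mono)
    fix \<omega> assume \<omega>: "\<omega> \<in> space M"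
    have nf: "N B \<omega> \<noteq> \<infinity>" unfolding N_def using num_points_eq_card[of X \<omega>, OF fin[OF \<omega>]] by simp
    have "(N B \<omega>)\<^sup>2 - N B \<omega> \<le> liminf (\<lambda>n. T n \<omega>)"
      using T_ev[OF \<omega>] by (intro Liminf_bounded, eventually_elim) (use nf in simp)
    then show "(N B \<omega>)\<^sup>2 \<le> N B \<omega> + liminf (\<lambda>n. T n \<omega>)"
      using ennreal_minus_le_iff[of "(N B \<omega>)\<^sup>2" "N B \<omega>"] nf by (simp add: top.not_eq_extremum)
  qed
  also have "\<dots> = (\<integral>\<^sup>+\<omega>. N B \<omega> \<partial>M) + (\<integral>\<^sup>+\<omega>. liminf (\<lambda>n. T n \<omega>) \<partial>M)"
    unfolding T_def by (rule nn_integral_add) measurable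
  also have "(\<integral>\<^sup>+\<omega>. liminf (\<lambda>n. T n \<omega>) \<partial>M) \<le> liminf (\<lambda>n. \<integral>\<^sup>+\<omega>. T n \<omega> \<partial>M)"
    unfolding T_def by (rule nn_integral_liminf) measurable
  also have "\<dots> \<le> (\<integral>\<^sup>+\<omega>. N B \<omega> \<partial>M)\<^sup>2"
    by (rule order_trans[OF Liminf_le_Limsup]) (auto intro!: Limsup_bounded always_eventually ET)
  finally show ?thesis unfolding N_def by (simp add: add_left_mono)
qed

section \<open>One- and two-point intensities of a determinantal process\<close>

lemma det_mat_two:
  fixes f :: "nat \<times> nat \<Rightarrow> 'a :: comm_ring_1"
  shows "Determinant.det (mat 2 2 f) = f (0, 0) * f (1, 1) - f (0, 1) * f (1, 0)"
proof -
  have "Determinant.det (mat 2 2 f) =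
      (\<Sum>i<2. mat 2 2 f $$ (i, 0) * cofactor (mat 2 2 f) i 0)"
    by (rule laplace_expansion_column) auto
  also have "\<dots> = f (0, 0) * f (1, 1) - f (0, 1) * f (1, 0)"
    by (simp add: cofactor_def mat_delete_def det_single numeral_2_eq_2 algebra_simps)
  finally show ?thesis .
qed

lemma nn_integral_PiM_one:
  assumes "sigma_finite_measure \<mu>" "f \<in> borel_measurable \<mu>"
  shows "(\<integral>\<^sup>+x. f (x 0) \<partial>PiM {..<1::nat} (\<lambda>_. \<mu>)) = (\<integral>\<^sup>+x. f x \<partial>\<mu>)"
proof -
  interpret product_sigma_finite "\<lambda>_ :: nat. \<mu>" 
    by (intro product_sigma_finite.intro assms(1))
  show ?thesis using product_nn_integral_singleton[of f 0] assms(2) by (simp add: lessThan_Suc)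
qed

lemma nn_integral_PiM_two:
  assumes "sigma_finite_measure \<mu>" "(\<lambda>(x, y). f x y) \<in> borel_measurable (\<mu> \<Otimes>\<^sub>M \<mu>)"
  shows "(\<integral>\<^sup>+x. f (x 0) (x 1) \<partial>PiM {..<2::nat} (\<lambda>_. \<mu>)) = (\<integral>\<^sup>+x. \<integral>\<^sup>+y. f x y \<partial>\<mu> \<partial>\<mu>)"
proof -
  interpret product_sigma_finite "\<lambda>_ :: nat. \<mu>" 
    by (intro product_sigma_finite.intro assms(1))
  interpret \<mu>: sigma_finite_measure \<mu> by (fact assms(1))
  note [measurable] = assms(2)
  have two: "{..<2::nat} = insert 1 {0}" by auto
  have inner: "(\<lambda>x. \<integral>\<^sup>+y. f x y \<partial>\<mu>) \<in> borel_measurable \<mu>" by measurable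
  have "(\<integral>\<^sup>+x. f (x 0) (x 1) \<partial>PiM {..<2::nat} (\<lambda>_. \<mu>)) =
      (\<integral>\<^sup>+x. \<integral>\<^sup>+y. f (x 0) y \<partial>\<mu> \<partial>PiM {0::nat} (\<lambda>_. \<mu>))"
    unfolding two by (subst product_nn_integral_insert) simp_all
  also have "\<dots> = (\<integral>\<^sup>+x. \<integral>\<^sup>+y. f x y \<partial>\<mu> \<partial>\<mu>)"
    by (rule product_nn_integral_singleton[OF inner])
  finally show ?thesis .
qed


lemma joint_intensities_nonneg:
  assumes "joint_intensities M \<mu> X \<rho>" "k \<ge> 1" "x \<in> space (PiM {..<k} (\<lambda>_. \<mu>))"
  shows "\<rho> k x \<ge> 0"
  using assms by (simp add: joint_intensities_def)

lemma joint_intensitiesD: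
  assumes "joint_intensities M \<mu> X \<rho>" "k \<ge> 1" "\<And>i. i < k \<Longrightarrow> D i \<in> sets \<mu>"
    "disjoint_family_on D {..<k}"
  shows "(\<integral>\<^sup>+\<omega>. (\<Prod>i<k. num_points X (D i) \<omega>) \<partial>M) =
    (\<integral>\<^sup>+x. ennreal (\<rho> k x) * indicator (PiE {..<k} D) x \<partial>PiM {..<k} (\<lambda>_. \<mu>))"
  using assms by (simp add: joint_intensities_def)

lemma determinantal_mean:
  assumes X: "determinantal_point_process M \<mu> K X"
    and \<mu>: "sigma_finite_measure \<mu>"
    and \<kappa>: "\<kappa> \<in> borel_measurable \<mu>" "\<And>x. x \<in> space \<mu> \<Longrightarrow> K x x = complex_of_real (\<kappa> x)"
    and B: "B \<in> sets \<mu>"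
  shows "(\<integral>\<^sup>+\<omega>. num_points X B \<omega> \<partial>M) = emeasure (density \<mu> (\<lambda>x. ennreal (\<kappa> x))) B"
proof -
  note [measurable] = \<kappa>(1) B
  obtain \<rho> where \<rho>: "joint_intensities M \<mu> X \<rho>"
    and "\<forall>k\<ge>1. \<forall>x\<in>space (PiM {..<k} (\<lambda>_. \<mu>)).
      complex_of_real (\<rho> k x) = Determinant.det (mat k k (\<lambda>(i, j). K (x i) (x j)))"
    using X unfolding determinantal_point_process_def by (elim conjE exE)
  note det = this(2)[rule_format]
  have \<rho>1: "\<rho> 1 x = \<kappa> (x 0)" if "x \<in> space (PiM {..<1} (\<lambda>_. \<mu>))" for x
  proof -
    have "x 0 \<in> space \<mu>" using that by (auto simp: space_PiM)
    then have "complex_of_real (\<rho> 1 x) = complex_of_real (\<kappa> (x 0))"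
      using det[of 1 x] that \<kappa>(2) by (simp add: det_single)
    then show ?thesis by simp
  qed
  have "(\<integral>\<^sup>+\<omega>. (\<Prod>i<1::nat. num_points X B \<omega>) \<partial>M) =
      (\<integral>\<^sup>+x. ennreal (\<rho> 1 x) * indicator (PiE {..<1} (\<lambda>_. B)) x \<partial>PiM {..<1} (\<lambda>_. \<mu>))"
    by (rule joint_intensitiesD[OF \<rho>]) (use B in \<open>auto simp: disjoint_family_on_def\<close>)
  also have "\<dots> = (\<integral>\<^sup>+x. ennreal (\<kappa> (x 0)) * indicator B (x 0) \<partial>PiM {..<1::nat} (\<lambda>_. \<mu>))"
  proof (intro nn_integral_cong)
    fix x assume x: "x \<in> space (PiM {..<1::nat} (\<lambda>_. \<mu>))"
    then have "x \<in> PiE {..<1} (\<lambda>_. B) \<longleftrightarrow> x 0 \<in> B" by (auto simp: space_PiM PiE_iff)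
    then show "ennreal (\<rho> 1 x) * indicator (PiE {..<1} (\<lambda>_. B)) x =
        ennreal (\<kappa> (x 0)) * indicator B (x 0)"
      unfolding \<rho>1[OF x] indicator_def by simp
  qed
  also have "\<dots> = (\<integral>\<^sup>+x. ennreal (\<kappa> x) * indicator B x \<partial>\<mu>)"
    by (intro nn_integral_PiM_one \<mu>) measurable
  also have "\<dots> = emeasure (density \<mu> (\<lambda>x. ennreal (\<kappa> x))) B"
    by (subst emeasure_density) (use B in measurable)
  finally show ?thesis by simp
qed

text \<open>
  Here \<open>G x y = K x y * K y x\<close>, which is \<open>\<bar>K x y\<bar>\<^sup>2\<close> for a Hermitian kernel: minus the double
  integral of \<open>G\<close> is the covariance of the counts in two disjoint sets.  The identity is written
  additively because all integrals are extended nonnegative reals.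
\<close>

lemma determinantal_disjoint_correlation:
  assumes X: "determinantal_point_process M \<mu> K X"
    and \<mu>: "sigma_finite_measure \<mu>"
    and \<kappa>: "\<kappa> \<in> borel_measurable \<mu>" "\<And>x. x \<in> space \<mu> \<Longrightarrow> K x x = complex_of_real (\<kappa> x)"
      "\<And>x. x \<in> space \<mu> \<Longrightarrow> \<kappa> x \<ge> 0"
    and G: "(\<lambda>(x, y). G x y) \<in> borel_measurable (\<mu> \<Otimes>\<^sub>M \<mu>)"
      "\<And>x y. x \<in> space \<mu> \<Longrightarrow> y \<in> space \<mu> \<Longrightarrow> K x y * K y x = complex_of_real (G x y)"
      "\<And>x y. x \<in> space \<mu> \<Longrightarrow> y \<in> space \<mu> \<Longrightarrow> G x y \<ge> 0"
    and A: "A \<in> sets \<mu>" and B: "B \<in> sets \<mu>" and AB: "A \<inter> B = {}"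
  shows "(\<integral>\<^sup>+\<omega>. num_points X A \<omega> * num_points X B \<omega> \<partial>M) +
      (\<integral>\<^sup>+x. (\<integral>\<^sup>+y. ennreal (G x y) * indicator B y \<partial>\<mu>) * indicator A x \<partial>\<mu>) =
      (\<integral>\<^sup>+\<omega>. num_points X A \<omega> \<partial>M) * (\<integral>\<^sup>+\<omega>. num_points X B \<omega> \<partial>M)"
proof -
  interpret \<mu>: sigma_finite_measure \<mu> by (fact \<mu>)
  note [measurable] = \<kappa>(1) G(1) A B
  have G_section: "(\<lambda>y. G x y) \<in> borel_measurable \<mu>" if "x \<in> space \<mu>" for x
    using measurable_compose[OF measurable_Pair1'[OF that] G(1)] by simp
  obtain \<rho> where \<rho>: "joint_intensities M \<mu> X \<rho>"
    and "\<forall>k\<ge>1. \<forall>x\<in>space (PiM {..<k} (\<lambda>_. \<mu>)).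
      complex_of_real (\<rho> k x) = Determinant.det (mat k k (\<lambda>(i, j). K (x i) (x j)))"
    using X unfolding determinantal_point_process_def by (elim conjE exE)
  note det = this(2)[rule_format]
  have \<rho>2: "\<rho> 2 x = \<kappa> (x 0) * \<kappa> (x 1) - G (x 0) (x 1)" if "x \<in> space (PiM {..<2} (\<lambda>_. \<mu>))" for x
  proof -
    have "x 0 \<in> space \<mu>" "x 1 \<in> space \<mu>" using that by (simp_all add: space_PiM PiE_iff)
    then have "complex_of_real (\<rho> 2 x) = complex_of_real (\<kappa> (x 0) * \<kappa> (x 1) - G (x 0) (x 1))"
      using det[of 2 x, OF _ that] \<kappa>(2)[of "x 0"] \<kappa>(2)[of "x 1"] G(2)[of "x 0" "x 1"]
      by (simp add: det_mat_two)
    then show ?thesis using of_real_eq_iff by blast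
  qed
  \<comment> \<open>a joint intensity is nonnegative everywhere, so no almost-everywhere argument is needed\<close>
  have nonneg: "\<kappa> a * \<kappa> b - G a b \<ge> 0" if "a \<in> space \<mu>" "b \<in> space \<mu>" for a b
  proof -
    let ?x = "\<lambda>i\<in>{..<2::nat}. if i = 0 then a else b"
    have "?x \<in> space (PiM {..<2} (\<lambda>_. \<mu>))" using that by (auto simp: space_PiM)
    moreover from this have "\<rho> 2 ?x \<ge> 0"
      by (intro joint_intensities_nonneg[OF \<rho>]) auto
    ultimately show ?thesis using \<rho>2[of ?x] by simp
  qed
  define D where "D i = (if i = 0 then A else B)" for i :: nat
  have dis: "disjoint_family_on D {..<2}" using AB by (auto simp: disjoint_family_on_def D_def)
  have "(\<integral>\<^sup>+\<omega>. (\<Prod>i<2. num_points X (D i) \<omega>) \<partial>M) =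
      (\<integral>\<^sup>+x. ennreal (\<rho> 2 x) * indicator (PiE {..<2} D) x \<partial>PiM {..<2} (\<lambda>_. \<mu>))"
    by (rule joint_intensitiesD[OF \<rho> _ _ dis]) (use A B in \<open>auto simp: D_def\<close>)
  also have "\<dots> = (\<integral>\<^sup>+x. ennreal (\<kappa> (x 0) * \<kappa> (x 1) - G (x 0) (x 1)) *
      (indicator A (x 0) * indicator B (x 1)) \<partial>PiM {..<2::nat} (\<lambda>_. \<mu>))"
  proof (intro nn_integral_cong)
    fix x assume x: "x \<in> space (PiM {..<2::nat} (\<lambda>_. \<mu>))"
    then have "x \<in> PiE {..<2} D \<longleftrightarrow> x 0 \<in> A \<and> x 1 \<in> B"
      by (auto simp: space_PiM PiE_iff D_def less_2_cases_iff)
    then show "ennreal (\<rho> 2 x) * indicator (PiE {..<2} D) x =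
        ennreal (\<kappa> (x 0) * \<kappa> (x 1) - G (x 0) (x 1)) * (indicator A (x 0) * indicator B (x 1))"
      unfolding \<rho>2[OF x] indicator_def by simp
  qed
  also have "\<dots> = (\<integral>\<^sup>+x. \<integral>\<^sup>+y. ennreal (\<kappa> x * \<kappa> y - G x y) * (indicator A x * indicator B y) \<partial>\<mu> \<partial>\<mu>)"
    by (intro nn_integral_PiM_two \<mu>) measurable
  finally have pair: "(\<integral>\<^sup>+\<omega>. num_points X A \<omega> * num_points X B \<omega> \<partial>M) =
      (\<integral>\<^sup>+x. \<integral>\<^sup>+y. ennreal (\<kappa> x * \<kappa> y - G x y) * (indicator A x * indicator B y) \<partial>\<mu> \<partial>\<mu>)"
    by (simp add: D_def numeral_2_eq_2 mult.commute)
  have "(\<integral>\<^sup>+\<omega>. num_points X A \<omega> * num_points X B \<omega> \<partial>M) +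
      (\<integral>\<^sup>+x. (\<integral>\<^sup>+y. ennreal (G x y) * indicator B y \<partial>\<mu>) * indicator A x \<partial>\<mu>) =
      (\<integral>\<^sup>+x. \<integral>\<^sup>+y. ennreal (\<kappa> x * \<kappa> y - G x y) * (indicator A x * indicator B y) \<partial>\<mu> \<partial>\<mu>) +
      (\<integral>\<^sup>+x. \<integral>\<^sup>+y. ennreal (G x y) * (indicator A x * indicator B y) \<partial>\<mu> \<partial>\<mu>)"
    unfolding pair
  proof (intro arg_cong2[where f = "(+)"] refl nn_integral_cong)
    fix x assume x: "x \<in> space \<mu>"
    note [measurable] = G_section[OF x]
    show "(\<integral>\<^sup>+y. ennreal (G x y) * indicator B y \<partial>\<mu>) * indicator A x =
        (\<integral>\<^sup>+y. ennreal (G x y) * (indicator A x * indicator B y) \<partial>\<mu>)"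
      by (subst nn_integral_multc[symmetric]) (auto simp: ac_simps)
  qed
  also have "\<dots> = (\<integral>\<^sup>+x. \<integral>\<^sup>+y. ennreal (\<kappa> x * \<kappa> y - G x y) * (indicator A x * indicator B y) +
      ennreal (G x y) * (indicator A x * indicator B y) \<partial>\<mu> \<partial>\<mu>)"
  proof (subst nn_integral_add[symmetric])
    show "(\<integral>\<^sup>+x. (\<integral>\<^sup>+y. ennreal (\<kappa> x * \<kappa> y - G x y) * (indicator A x * indicator B y) \<partial>\<mu>) +
        (\<integral>\<^sup>+y. ennreal (G x y) * (indicator A x * indicator B y) \<partial>\<mu>) \<partial>\<mu>) =
        (\<integral>\<^sup>+x. \<integral>\<^sup>+y. ennreal (\<kappa> x * \<kappa> y - G x y) * (indicator A x * indicator B y) +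
          ennreal (G x y) * (indicator A x * indicator B y) \<partial>\<mu> \<partial>\<mu>)"
    proof (intro nn_integral_cong nn_integral_add[symmetric])
      fix x assume x: "x \<in> space \<mu>"
      note [measurable] = G_section[OF x]
      show "(\<lambda>y. ennreal (\<kappa> x * \<kappa> y - G x y) * (indicator A x * indicator B y)) \<in> borel_measurable \<mu>"
        "(\<lambda>y. ennreal (G x y) * (indicator A x * indicator B y)) \<in> borel_measurable \<mu>"
        by measurable
    qed
  qed measurable
  also have "\<dots> = (\<integral>\<^sup>+x. \<integral>\<^sup>+y. (ennreal (\<kappa> x) * indicator A x) * (ennreal (\<kappa> y) * indicator B y) \<partial>\<mu> \<partial>\<mu>)"
  proof (intro nn_integral_cong)
    fix x y assume xy: "x \<in> space \<mu>" "y \<in> space \<mu>"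
    have "ennreal (\<kappa> x * \<kappa> y - G x y) + ennreal (G x y) = ennreal (\<kappa> x) * ennreal (\<kappa> y)"
      using nonneg[OF xy] G(3)[OF xy] \<kappa>(3)[OF xy(1)] \<kappa>(3)[OF xy(2)]
      by (simp add: ennreal_plus[symmetric] ennreal_mult' del: ennreal_plus)
    then show "ennreal (\<kappa> x * \<kappa> y - G x y) * (indicator A x * indicator B y) +
        ennreal (G x y) * (indicator A x * indicator B y) =
        (ennreal (\<kappa> x) * indicator A x) * (ennreal (\<kappa> y) * indicator B y)"
      by (simp split: split_indicator add: add.commute)
  qed
  also have "\<dots> = (\<integral>\<^sup>+x. ennreal (\<kappa> x) * indicator A x \<partial>\<mu>) * (\<integral>\<^sup>+y. ennreal (\<kappa> y) * indicator B y \<partial>\<mu>)"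
    by (simp add: nn_integral_cmult nn_integral_multc)
  also have "\<dots> = (\<integral>\<^sup>+\<omega>. num_points X A \<omega> \<partial>M) * (\<integral>\<^sup>+\<omega>. num_points X B \<omega> \<partial>M)"
    using determinantal_mean[OF X \<mu> \<kappa>(1,2) A] determinantal_mean[OF X \<mu> \<kappa>(1,2) B]
    by (simp add: emeasure_density)
  finally show ?thesis .
qed

section \<open>The kernel and the first intensity on the disk\<close>

text \<open>The diagonal value \<open>disk_kernel L z z\<close>, as a real number.\<close>

definition disk_diagonal :: "real \<Rightarrow> complex \<Rightarrow> real" where
  "disk_diagonal L z = (1 - (cmod z)\<^sup>2) powr - (L + 1)"

text \<open>The squared modulus of \<open>disk_kernel L z w\<close>, written as a real power.\<close>

definition disk_kernel_sq :: "real \<Rightarrow> complex \<Rightarrow> complex \<Rightarrow> real" where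
  "disk_kernel_sq L z w = cmod (1 - z * cnj w) powr - (2 * (L + 1))"

text \<open>
  The mean measure of the process: \<open>disk_intensity L B\<close> is the expected number of points in \<open>B\<close>.
  By \<open>emeasure_disk_intensity\<close> its Lebesgue density is \<open>L / pi / (1 - \<bar>z\<bar>\<^sup>2)\<^sup>2\<close>.
\<close>

definition disk_intensity :: "real \<Rightarrow> complex measure" where
  "disk_intensity L = density (disk_measure L) (\<lambda>z. ennreal (disk_diagonal L z))"

lemma disk_diagonal_nonneg: "disk_diagonal L z \<ge> 0"
  by (simp add: disk_diagonal_def)

lemma disk_kernel_sq_nonneg: "disk_kernel_sq L z w \<ge> 0"
  by (simp add: disk_kernel_sq_def)

lemma disk_kernel_diagonal:
  assumes "cmod z < 1"
  shows "disk_kernel L z z = complex_of_real (disk_diagonal L z)"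
proof -
  have "(cmod z)\<^sup>2 < 1" using assms by (simp add: power_less_one_iff)
  then have "complex_of_real ((1 - (cmod z)\<^sup>2) powr (L + 1)) =
      complex_of_real (1 - (cmod z)\<^sup>2) powr complex_of_real (L + 1)"
    by (intro powr_of_real[symmetric]) simp
  moreover have "1 - z * cnj z = complex_of_real (1 - (cmod z)\<^sup>2)"
    using complex_norm_square[of z] by simp
  ultimately show ?thesis
    unfolding disk_kernel_def disk_diagonal_def powr_minus by (simp add: divide_inverse)
qed

lemma disk_kernel_mult_swap:
  assumes "cmod z < 1" "cmod w < 1"
  shows "disk_kernel L z w * disk_kernel L w z = complex_of_real (disk_kernel_sq L z w)"
proof -
  let ?p = "1 - z * cnj w"
  have "cmod (z * cnj w) < 1"
    using assms mult_strict_mono'[of "cmod z" 1 "cmod w" 1] by (simp add: norm_mult)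
  then have "Re ?p > 0" using complex_Re_le_cmod[of "z * cnj w"] by simp
  then have np: "?p \<notin> \<real>\<^sub>\<le>\<^sub>0" by (auto simp: complex_nonpos_Reals_iff)
  have "disk_kernel L w z = cnj (disk_kernel L z w)"
    using cnj_powr[of ?p "complex_of_real (L + 1)"] np
    unfolding disk_kernel_def by (auto simp: mult.commute complex_nonpos_Reals_iff complex_is_Real_iff)
  then have "disk_kernel L z w * disk_kernel L w z = complex_of_real ((cmod (disk_kernel L z w))\<^sup>2)"
    by (simp only: complex_norm_square)
  moreover have "(cmod (disk_kernel L z w))\<^sup>2 = disk_kernel_sq L z w"
    unfolding disk_kernel_def disk_kernel_sq_def powr_minus norm_divide
    by (simp add: norm_powr_real_powr' power_divide inverse_eq_divide
        power2_eq_square powr_add[symmetric])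
  ultimately show ?thesis by simp
qed

lemma space_disk_measure [simp]: "space (disk_measure L) = ball 0 1"
  by (simp add: disk_measure_def space_restrict_space)

lemma sets_disk_measure: "sets (disk_measure L) = sets (restrict_space borel (ball 0 1))"
  by (simp add: disk_measure_def sets_restrict_space)

lemma sets_disk_measureI [intro]:
  "B \<in> sets borel \<Longrightarrow> B \<subseteq> ball 0 1 \<Longrightarrow> B \<in> sets (disk_measure L)"
  by (simp add: sets_disk_measure sets_restrict_space_iff)

lemma sigma_finite_disk_measure: "sigma_finite_measure (disk_measure L)"
proof -
  interpret R: sigma_finite_measure "restrict_space lborel (ball (0 :: complex) 1)"
    by (intro sigma_finite_measure_restrict_space sigma_finite_lborel) simp
  show ?thesis unfolding disk_measure_def
    by (subst R.sigma_finite_iff_density_finite) (auto intro!: measurable_restrict_space1)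
qed

lemma disk_diagonal_measurable: "disk_diagonal L \<in> borel_measurable (disk_measure L)"
  unfolding disk_measure_def disk_diagonal_def by (auto intro!: measurable_restrict_space1)

lemma disk_kernel_sq_measurable:
  "(\<lambda>(z, w). disk_kernel_sq L z w) \<in> borel_measurable (disk_measure L \<Otimes>\<^sub>M disk_measure L)"
proof -
  have id: "(\<lambda>z. z) \<in> measurable (disk_measure L) borel"
    unfolding disk_measure_def by (auto intro!: measurable_restrict_space1)
  have [measurable]: "cnj \<in> borel_measurable borel"
    by (intro borel_measurable_continuous_onI continuous_intros)
  have "(\<lambda>(z, w). disk_kernel_sq L z w) \<in> borel_measurable (borel \<Otimes>\<^sub>M borel)"
    unfolding disk_kernel_sq_def split_def by measurable
  moreover have "(\<lambda>p. (fst p, snd p)) \<in> measurable (disk_measure L \<Otimes>\<^sub>M disk_measure L) (borel \<Otimes>\<^sub>M borel)"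
    by (intro measurable_Pair measurable_compose[OF measurable_fst id]
        measurable_compose[OF measurable_snd id])
  ultimately show ?thesis by (auto dest: measurable_compose simp: split_def)
qed

text \<open>
  The exponent \<open>L - 1\<close> may have either sign.  Writing \<open>t powr (L - 1)\<close> as \<open>t powr (L + 1) / t\<^sup>2\<close>
  gives a lower bound valid for all positive \<open>L\<close>.
\<close>

lemma disk_density_ge:
  fixes t :: real
  assumes "L > 0" "s > 0" "s / 2 \<le> t" "t \<le> 4 * s"
  shows "L / pi * ((s / 2) powr (L + 1) / (16 * s\<^sup>2)) \<le> L / pi * t powr (L - 1)"
proof -
  have t: "t > 0" using assms by linarith
  have "(s / 2) powr (L + 1) / (16 * s\<^sup>2) \<le> t powr (L + 1) / t\<^sup>2"
    using assms t power_mono[of t "4 * s" 2]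
    by (intro frac_le powr_mono2) (auto simp: power_mult_distrib)
  also have "\<dots> = t powr (L - 1)"
    using t powr_diff[of t "L + 1" 2] by (simp add: powr_numeral)
  finally show ?thesis using assms(1) by (intro mult_left_mono) auto
qed

lemma emeasure_disk_measure_ge:
  assumes "L > 0" "s > 0" "E \<in> sets borel"
    and E: "\<And>z. z \<in> E \<Longrightarrow> s / 2 \<le> 1 - (cmod z)\<^sup>2 \<and> 1 - (cmod z)\<^sup>2 \<le> 4 * s"
  shows "ennreal (L / pi * ((s / 2) powr (L + 1) / (16 * s\<^sup>2))) * emeasure lborel E
    \<le> emeasure (disk_measure L) E"
proof -
  let ?c = "L / pi * ((s / 2) powr (L + 1) / (16 * s\<^sup>2))"
  have sub: "E \<subseteq> ball 0 1"
  proof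
    fix z assume "z \<in> E"
    then have "(cmod z)\<^sup>2 < 1" using E[of z] \<open>s > 0\<close> by linarith
    then show "z \<in> ball 0 1" by (simp add: abs_square_less_1)
  qed
  have "ennreal ?c * emeasure lborel E = (\<integral>\<^sup>+z. ennreal ?c * indicator E z \<partial>lborel)"
    using assms(3) by (simp add: nn_integral_cmult_indicator)
  also have "\<dots> \<le> (\<integral>\<^sup>+z. ennreal (L / pi * (1 - (cmod z)\<^sup>2) powr (L - 1)) * indicator E z \<partial>lborel)"
  proof (intro nn_integral_mono)
    fix z :: complex
    show "ennreal ?c * indicator E z \<le>
        ennreal (L / pi * (1 - (cmod z)\<^sup>2) powr (L - 1)) * indicator E z"
    proof (cases "z \<in> E")
      case True
      then show ?thesis using disk_density_ge[OF assms(1,2), of "1 - (cmod z)\<^sup>2"] E[of z]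
        by (auto intro!: ennreal_leI)
    qed simp
  qed
  also have "\<dots> = (\<integral>\<^sup>+z. ennreal (L / pi * (1 - (cmod z)\<^sup>2) powr (L - 1)) * indicator E z * indicator (ball 0 1) z \<partial>lborel)"
    using sub by (intro nn_integral_cong) (auto simp: indicator_def)
  also have "\<dots> = emeasure (disk_measure L) E"
    unfolding disk_measure_def using sub assms(3)
    by (subst emeasure_density)
      (auto simp: nn_integral_restrict_space sets_restrict_space_iff intro!: measurable_restrict_space1)
  finally show ?thesis .
qed

lemma emeasure_disk_intensity:
  assumes "L > 0" "B \<in> sets borel" "B \<subseteq> ball 0 1"
  shows "emeasure (disk_intensity L) B =
    (\<integral>\<^sup>+z. ennreal (L / pi / (1 - (cmod z)\<^sup>2)\<^sup>2) * indicator B z \<partial>lborel)"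
proof -
  note [measurable] = disk_diagonal_measurable
  have B: "B \<in> sets (disk_measure L)" using assms by blast
  have "emeasure (disk_intensity L) B =
      (\<integral>\<^sup>+z. ennreal (disk_diagonal L z) * indicator B z \<partial>disk_measure L)"
    unfolding disk_intensity_def using B by (intro emeasure_density) measurable
  also have "\<dots> = (\<integral>\<^sup>+z. ennreal (L / pi * (1 - (cmod z)\<^sup>2) powr (L - 1)) *
      (ennreal (disk_diagonal L z) * indicator B z) \<partial>restrict_space lborel (ball 0 1))"
    unfolding disk_measure_def using B assms
    by (subst nn_integral_density)
      (auto simp: disk_diagonal_def intro!: measurable_restrict_space1)
  also have "\<dots> = (\<integral>\<^sup>+z. ennreal (L / pi * (1 - (cmod z)\<^sup>2) powr (L - 1)) *
      (ennreal (disk_diagonal L z) * indicator B z) * indicator (ball 0 1) z \<partial>lborel)"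
    by (subst nn_integral_restrict_space) auto
  also have "\<dots> = (\<integral>\<^sup>+z. ennreal (L / pi / (1 - (cmod z)\<^sup>2)\<^sup>2) * indicator B z \<partial>lborel)"
  proof (intro nn_integral_cong)
    fix z :: complex
    show "ennreal (L / pi * (1 - (cmod z)\<^sup>2) powr (L - 1)) *
        (ennreal (disk_diagonal L z) * indicator B z) * indicator (ball 0 1) z =
        ennreal (L / pi / (1 - (cmod z)\<^sup>2)\<^sup>2) * indicator B z"
    proof (cases "z \<in> B")
      case True
      then have "cmod z < 1" using assms(3) by auto
      then have t: "1 - (cmod z)\<^sup>2 > 0" by (simp add: power_less_one_iff)
      have "(1 - (cmod z)\<^sup>2) powr (L - 1) * (1 - (cmod z)\<^sup>2) powr - (L + 1) = (1 - (cmod z)\<^sup>2) powr (- 2)"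
        by (simp add: powr_add[symmetric])
      also have "\<dots> = 1 / (1 - (cmod z)\<^sup>2)\<^sup>2"
        using t by (simp add: powr_minus_divide powr_numeral)
      finally have "L / pi * (1 - (cmod z)\<^sup>2) powr (L - 1) * disk_diagonal L z = L / pi / (1 - (cmod z)\<^sup>2)\<^sup>2"
        unfolding disk_diagonal_def by (simp add: mult.assoc)
      then show ?thesis using True assms \<open>cmod z < 1\<close>
        by (simp add: ennreal_mult''[symmetric] disk_diagonal_def)
    qed simp
  qed
  finally show ?thesis .
qed

lemma emeasure_disk_intensity_le:
  assumes "L > 0" "s > 0" "B \<in> sets borel" "B \<subseteq> ball 0 (1 - s)"
  shows "emeasure (disk_intensity L) B \<le> ennreal (L / pi / s\<^sup>2) * emeasure lborel B"
proof -
  have "emeasure (disk_intensity L) B =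
      (\<integral>\<^sup>+z. ennreal (L / pi / (1 - (cmod z)\<^sup>2)\<^sup>2) * indicator B z \<partial>lborel)"
    using assms by (intro emeasure_disk_intensity) auto
  also have "\<dots> \<le> (\<integral>\<^sup>+z. ennreal (L / pi / s\<^sup>2) * indicator B z \<partial>lborel)"
  proof (intro nn_integral_mono)
    fix z :: complex
    show "ennreal (L / pi / (1 - (cmod z)\<^sup>2)\<^sup>2) * indicator B z \<le> ennreal (L / pi / s\<^sup>2) * indicator B z"
    proof (cases "z \<in> B")
      case True
      then have z: "cmod z < 1 - s" using assms(4) by auto
      then have "(cmod z)\<^sup>2 \<le> cmod z * 1"
        unfolding power2_eq_square using \<open>s > 0\<close> by (intro mult_left_mono) auto
      then have "s \<le> 1 - (cmod z)\<^sup>2" using z by linarith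
      then have "s\<^sup>2 \<le> (1 - (cmod z)\<^sup>2)\<^sup>2" using assms(2) by (intro power_mono) auto
      moreover from this have "0 < (1 - (cmod z)\<^sup>2)\<^sup>2" using assms(2)
        by (meson less_le_trans zero_less_power)
      ultimately show ?thesis using True assms by (auto intro!: ennreal_leI divide_left_mono)
    qed simp
  qed
  also have "\<dots> = ennreal (L / pi / s\<^sup>2) * emeasure lborel B"
    using assms(3) by (simp add: nn_integral_cmult_indicator)
  finally show ?thesis .
qed

lemma emeasure_complex_annulus:
  assumes "0 \<le> a" "a \<le> b"
  shows "emeasure lborel (ball (0::complex) b - ball 0 a) = ennreal (pi * (b\<^sup>2 - a\<^sup>2))"
proof -
  have "emeasure lborel (ball (0::complex) b - ball 0 a) =
      emeasure lborel (ball (0::complex) b) - emeasure lborel (ball (0::complex) a)"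
    using assms by (intro emeasure_Diff) (auto simp: emeasure_ball subset_ball)
  also have "\<dots> = ennreal (pi * (b\<^sup>2 - a\<^sup>2))"
    using assms by (simp add: emeasure_ball unit_ball_vol_2 ennreal_minus right_diff_distrib)
  finally show ?thesis .
qed

text \<open>
  The bound is propagated from \<open>2 * s\<close> to \<open>s\<close>: the annulus between the radii \<open>1 - 2 * s\<close> and
  \<open>1 - s\<close> has area at most \<open>2 * pi * s\<close> and density at most \<open>L / pi / s\<^sup>2\<close>, so it contributes at most
  \<open>2 * L / s\<close>, and \<open>4 * L / (2 * s) + 2 * L / s = 4 * L / s\<close>.  Balls of nonpositive radius are empty.
\<close>

lemma emeasure_disk_intensity_ball:
  assumes "L > 0" "s > 0"
  shows "emeasure (disk_intensity L) (ball 0 (1 - s)) \<le> ennreal (4 * L / s)"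
proof -
  have step: "emeasure (disk_intensity L) (ball 0 (1 - s)) \<le> ennreal (4 * L / s)"
    if "s > 0" "1 / 2 ^ k \<le> s" for k :: nat and s
    using that
  proof (induction k arbitrary: s)
    case 0
    then have "ball (0::complex) (1 - s) = {}" by simp
    then show ?case by (metis emeasure_empty zero_le)
  next
    case (Suc k)
    show ?case
    proof (cases "s < 1")
      case False
      then have "ball (0::complex) (1 - s) = {}" by simp
      then show ?thesis by (metis emeasure_empty zero_le)
    next
      case True
      let ?a = "max 0 (1 - 2 * s)"
      let ?R = "ball (0::complex) (1 - s) - ball 0 ?a"
      have IH: "emeasure (disk_intensity L) (ball 0 (1 - 2 * s)) \<le> ennreal (4 * L / (2 * s))"
        using Suc.prems by (intro Suc.IH) (auto simp: field_simps)
      have eq: "ball (0::complex) ?a = ball 0 (1 - 2 * s)"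
        by (auto simp: max_def) (use norm_ge_zero in \<open>smt (verit)\<close>)
      have "(1 - s)\<^sup>2 - ?a\<^sup>2 \<le> 2 * s"
      proof (cases "2 * s \<le> 1")
        case False
        have "s * s \<le> s" using mult_left_mono[of s 1 s] Suc.prems True by linarith
        moreover have "(1 - s)\<^sup>2 - ?a\<^sup>2 = 1 - 2 * s + s * s"
          using False by (simp add: power2_eq_square algebra_simps)
        ultimately show ?thesis using False by linarith
      qed (simp add: power2_eq_square algebra_simps)
      then have "emeasure lborel ?R \<le> ennreal (pi * (2 * s))"
        using Suc.prems True by (subst emeasure_complex_annulus) (auto intro!: ennreal_leI)
      then have "ennreal (L / pi / s\<^sup>2) * emeasure lborel ?R \<le> ennreal (L / pi / s\<^sup>2) * ennreal (pi * (2 * s))"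
        by (rule mult_left_mono) simp
      also have "\<dots> = ennreal (2 * L / s)"
        using Suc.prems assms by (simp add: ennreal_mult'[symmetric] power2_eq_square field_simps)
      finally have R: "emeasure (disk_intensity L) ?R \<le> ennreal (2 * L / s)"
        using emeasure_disk_intensity_le[OF assms(1) Suc.prems(1), of ?R] by (auto intro: order_trans)
      have sets: "C \<in> sets (disk_intensity L)" if "C \<in> sets borel" "C \<subseteq> ball 0 1" for C
        using sets_disk_measureI[OF that, of L] by (simp add: disk_intensity_def)
      have U: "ball (0::complex) (1 - 2 * s) \<in> sets (disk_intensity L)" "?R \<in> sets (disk_intensity L)"
        using Suc.prems by (auto intro!: sets)
      have "ball (0::complex) (1 - s) = ball 0 (1 - 2 * s) \<union> ?R"
        unfolding eq using Suc.prems by auto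
      then have "emeasure (disk_intensity L) (ball 0 (1 - s)) \<le>
          emeasure (disk_intensity L) (ball 0 (1 - 2 * s)) + emeasure (disk_intensity L) ?R"
        by (metis (no_types, lifting) U(1,2) emeasure_subadditive)
      also have "\<dots> \<le> ennreal (4 * L / (2 * s)) + ennreal (2 * L / s)"
        by (intro add_mono IH R)
      also have "\<dots> = ennreal (4 * L / s)"
        using Suc.prems assms by (subst ennreal_plus[symmetric]) (auto simp: field_simps)
      finally show ?thesis .
    qed
  qed
  obtain k where "(1 / 2) ^ k < s" using real_arch_pow_inv[of s "1 / 2"] assms by auto
  then show ?thesis using assms step[of s k] by (simp add: power_one_over)
qed

section \<open>Covariance with the adjacent annulus\<close>

lemma one_minus_square_bounds:
  fixes t :: real
  assumes "0 \<le> t" "t \<le> 1"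
  shows "1 - t \<le> 1 - t\<^sup>2" "1 - t\<^sup>2 \<le> 2 * (1 - t)"
proof -
  have "t\<^sup>2 \<le> t" using assms by (simp add: power2_eq_square mult_left_le)
  then show "1 - t \<le> 1 - t\<^sup>2" by simp
  have "0 \<le> (1 - t)\<^sup>2" by simp
  then show "1 - t\<^sup>2 \<le> 2 * (1 - t)" by (simp add: power2_eq_square algebra_simps)
qed

lemma disk_kernel_sq_ge:
  assumes "L > 0" "cmod x < 1" "cmod y < 1" "1 - 2 * s \<le> cmod x" "dist x y \<le> 2 * s"
  shows "(6 * s) powr - (2 * (L + 1)) \<le> disk_kernel_sq L x y"
proof -
  have "cmod (x * cnj y) < 1"
    using assms mult_strict_mono'[of "cmod x" 1 "cmod y" 1] by (simp add: norm_mult)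
  then have pos: "cmod (1 - x * cnj y) > 0" by auto
  have "1 - x * cnj y = complex_of_real (1 - (cmod x)\<^sup>2) + x * cnj (x - y)"
    using complex_norm_square[of x] by (simp add: algebra_simps)
  then have "cmod (1 - x * cnj y) \<le> \<bar>1 - (cmod x)\<^sup>2\<bar> + cmod x * cmod (x - y)"
    using norm_triangle_ineq[of "complex_of_real (1 - (cmod x)\<^sup>2)" "x * cnj (x - y)"]
    by (simp only: norm_mult complex_mod_cnj norm_of_real)
  moreover have "\<bar>1 - (cmod x)\<^sup>2\<bar> \<le> 4 * s"
    using one_minus_square_bounds[of "cmod x"] assms by simp
  moreover have "cmod x * cmod (x - y) \<le> 1 * (2 * s)"
    using assms by (intro mult_mono) (auto simp: dist_norm)
  ultimately have "cmod (1 - x * cnj y) \<le> 6 * s" by linarith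
  then show ?thesis unfolding disk_kernel_sq_def
    using pos assms(1) by (intro powr_mono2') auto
qed

text \<open>
  The points of \<open>D\<close> at distance between \<open>s\<close> and \<open>2 * s\<close> from the unit circle fill an area of order
  \<open>s\<close>, and each of them has within distance \<open>2 * s\<close> a ball of radius \<open>s / 4\<close> contained in \<open>A\<close>.
  On such pairs the kernel squared is at least \<open>(6 * s) powr - (2 * (L + 1))\<close> and both densities
  are at least of order \<open>s powr (L - 1)\<close>; with the areas, of orders \<open>s\<close> and \<open>s\<^sup>2\<close>, the product of
  these orders is \<open>1 / s\<close>.
\<close>

lemma disk_covariance_ge:
  assumes L: "L > 0" and s: "0 < s" "s \<le> 1 / 4"
  defines "D \<equiv> ball 0 (1 - s)"
    and "A \<equiv> ball 0 (1 - s / 2) - ball 0 (1 - s)"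
  shows "ennreal (L\<^sup>2 / 4096 * (1 / 12) powr (2 * (L + 1)) / s) \<le>
    (\<integral>\<^sup>+x. (\<integral>\<^sup>+y. ennreal (disk_kernel_sq L x y) * indicator A y \<partial>disk_measure L) * indicator D x
      \<partial>disk_measure L)"
proof -
  let ?\<mu> = "disk_measure L"
  \<comment> \<open>\<open>b\<close> bounds the density of \<open>disk_measure L\<close> from below and \<open>g\<close> bounds the squared kernel\<close>
  define b where "b = L / pi * ((s / 2) powr (L + 1) / (16 * s\<^sup>2))"
  define g where "g = (6 * s) powr - (2 * (L + 1))"
  define D' where "D' = ball (0::complex) (1 - s) - ball 0 (1 - 2 * s)"
  have bg: "b \<ge> 0" "g \<ge> 0" using L s by (auto simp: b_def g_def)
  have inner: "ennreal (g * (b * (pi * (s / 4)\<^sup>2))) \<le>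
      (\<integral>\<^sup>+y. ennreal (disk_kernel_sq L x y) * indicator A y \<partial>?\<mu>)" if x: "x \<in> D'" for x
  proof -
    have cx: "1 - 2 * s \<le> cmod x" "cmod x < 1 - s" using x by (auto simp: D'_def)
    then have x0: "cmod x > 0" using s by linarith
    \<comment> \<open>the point on the ray through \<open>x\<close> halfway between the two boundary circles of \<open>A\<close>\<close>
    define p where "p = complex_of_real ((1 - 3 * s / 4) / cmod x) * x"
    define E where "E = ball p (s / 4)"
    have cp: "cmod p = 1 - 3 * s / 4" unfolding p_def norm_mult norm_of_real using x0 s by simp
    have "x - p = complex_of_real ((cmod x - (1 - 3 * s / 4)) / cmod x) * x"
      unfolding p_def using x0 by (simp add: field_simps)
    then have "dist x p = \<bar>cmod x - (1 - 3 * s / 4)\<bar>"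
      by (simp only: dist_norm norm_mult norm_of_real abs_divide) (use x0 in simp)
    then have xp: "dist x p \<le> 5 / 4 * s" using cx by linarith
    have E: "1 - s < cmod y" "cmod y < 1 - s / 2" "dist x y \<le> 2 * s" if "y \<in> E" for y
    proof -
      have "dist p y < s / 4" using that by (simp add: E_def)
      then have "\<bar>cmod p - cmod y\<bar> < s / 4"
        using norm_triangle_ineq3[of p y] by (simp add: dist_norm)
      then show "1 - s < cmod y" "cmod y < 1 - s / 2" using cp by linarith+
      show "dist x y \<le> 2 * s"
        using dist_triangle[of x y p] xp \<open>dist p y < s / 4\<close> s by linarith
    qed
    have E_sets: "E \<in> sets ?\<mu>" using E s by (intro sets_disk_measureI) (force simp: E_def)+
    have "ennreal b * ennreal (pi * (s / 4)\<^sup>2) = ennreal b * emeasure lborel E"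
      using s by (simp add: E_def emeasure_ball unit_ball_vol_2)
    also have "\<dots> \<le> emeasure ?\<mu> E"
      unfolding b_def
    proof (rule emeasure_disk_measure_ge)
      fix z assume z: "z \<in> E"
      then show "s / 2 \<le> 1 - (cmod z)\<^sup>2 \<and> 1 - (cmod z)\<^sup>2 \<le> 4 * s"
        using one_minus_square_bounds[of "cmod z"] E[OF z] s by simp
    qed (use L s in \<open>auto simp: E_def\<close>)
    finally have "ennreal g * (ennreal b * ennreal (pi * (s / 4)\<^sup>2)) \<le> ennreal g * emeasure ?\<mu> E"
      by (rule mult_left_mono) simp
    also have "\<dots> = (\<integral>\<^sup>+y. ennreal g * indicator E y \<partial>?\<mu>)"
      using E_sets by (simp add: nn_integral_cmult_indicator)
    also have "\<dots> \<le> (\<integral>\<^sup>+y. ennreal (disk_kernel_sq L x y) * indicator A y \<partial>?\<mu>)"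
    proof (intro nn_integral_mono)
      fix y
      show "ennreal g * indicator E y \<le> ennreal (disk_kernel_sq L x y) * indicator A y"
      proof (cases "y \<in> E")
        case True
        then have "y \<in> A" using E[OF True] by (simp add: A_def)
        moreover have "g \<le> disk_kernel_sq L x y"
          unfolding g_def using L s cx E[OF True] by (intro disk_kernel_sq_ge) auto
        ultimately show ?thesis using True by (simp add: ennreal_leI)
      qed simp
    qed
    finally show ?thesis using bg by (simp add: ennreal_mult)
  qed
  have D'_area: "ennreal (pi * s) \<le> emeasure lborel D'"
  proof -
    have "s \<le> (1 - s)\<^sup>2 - (1 - 2 * s)\<^sup>2"
      using s mult_left_mono[of s "1 / 4" s] by (simp add: power2_eq_square algebra_simps)
    then show ?thesis unfolding D'_def using s
      by (subst emeasure_complex_annulus) (auto intro!: ennreal_leI)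
  qed
  have D'_sets: "D' \<in> sets ?\<mu>" using s by (intro sets_disk_measureI) (auto simp: D'_def)
  have "ennreal b * ennreal (pi * s) \<le> ennreal b * emeasure lborel D'"
    by (intro mult_left_mono D'_area) simp
  also have "\<dots> \<le> emeasure ?\<mu> D'"
    unfolding b_def
  proof (rule emeasure_disk_measure_ge)
    fix z assume "z \<in> D'"
    then show "s / 2 \<le> 1 - (cmod z)\<^sup>2 \<and> 1 - (cmod z)\<^sup>2 \<le> 4 * s"
      using one_minus_square_bounds[of "cmod z"] s by (simp add: D'_def)
  qed (use L s in \<open>auto simp: D'_def\<close>)
  finally have outer: "ennreal (b * (pi * s)) \<le> emeasure ?\<mu> D'"
    using bg s by (simp add: ennreal_mult)
  have "L\<^sup>2 / 4096 * (1 / 12) powr (2 * (L + 1)) / s = g * (b * (pi * (s / 4)\<^sup>2)) * (b * (pi * s))"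
  proof -
    have "(1 / 12) powr (2 * (L + 1)) = (s / 2 / (6 * s)) powr (2 * (L + 1))" using s by simp
    also have "\<dots> = (s / 2) powr (2 * (L + 1)) / (6 * s) powr (2 * (L + 1))"
      by (rule powr_divide)
    also have "\<dots> = (s / 2) powr (2 * (L + 1)) * g"
      unfolding g_def powr_minus by (rule divide_inverse)
    also have "(s / 2) powr (2 * (L + 1)) = ((s / 2) powr (L + 1))\<^sup>2"
      by (simp add: power2_eq_square powr_add[symmetric])
    finally show ?thesis unfolding b_def using s by (simp add: field_simps power2_eq_square)
  qed
  then have "ennreal (L\<^sup>2 / 4096 * (1 / 12) powr (2 * (L + 1)) / s) =
      ennreal (g * (b * (pi * (s / 4)\<^sup>2))) * ennreal (b * (pi * s))"
    using bg s by (simp only:) (intro ennreal_mult; simp)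
  also have "\<dots> \<le> ennreal (g * (b * (pi * (s / 4)\<^sup>2))) * emeasure ?\<mu> D'"
    by (intro mult_left_mono outer) simp
  also have "\<dots> = (\<integral>\<^sup>+x. ennreal (g * (b * (pi * (s / 4)\<^sup>2))) * indicator D' x \<partial>?\<mu>)"
    using D'_sets by (simp add: nn_integral_cmult_indicator)
  also have "\<dots> \<le> (\<integral>\<^sup>+x. (\<integral>\<^sup>+y. ennreal (disk_kernel_sq L x y) * indicator A y \<partial>?\<mu>) * indicator D x \<partial>?\<mu>)"
  proof (intro nn_integral_mono)
    fix x
    show "ennreal (g * (b * (pi * (s / 4)\<^sup>2))) * indicator D' x \<le>
      (\<integral>\<^sup>+y. ennreal (disk_kernel_sq L x y) * indicator A y \<partial>?\<mu>) * indicator D x"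
    proof (cases "x \<in> D'")
      case True
      then have "x \<in> D" by (simp add: D'_def D_def)
      then show ?thesis using inner[OF True] True by simp
    qed simp
  qed
  finally show ?thesis .
qed

section \<open>Variance of the number of points\<close>

lemma (in prob_space) variance_add_scaled_nonneg:
  fixes Y Z :: "'a \<Rightarrow> real"
  assumes [simp]: "integrable M Y" "integrable M Z" "integrable M (\<lambda>\<omega>. (Y \<omega>)\<^sup>2)"
    "integrable M (\<lambda>\<omega>. (Z \<omega>)\<^sup>2)" "integrable M (\<lambda>\<omega>. Y \<omega> * Z \<omega>)"
  shows "0 \<le> variance Y + 2 * t * (expectation (\<lambda>\<omega>. Y \<omega> * Z \<omega>) - expectation Y * expectation Z) +
    t\<^sup>2 * variance Z"
proof -
  have sq: "(\<lambda>\<omega>. (Y \<omega> + t * Z \<omega>)\<^sup>2) = (\<lambda>\<omega>. (Y \<omega>)\<^sup>2 + (2 * t) * (Y \<omega> * Z \<omega>) + t\<^sup>2 * (Z \<omega>)\<^sup>2)"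
    by (auto simp: power2_eq_square algebra_simps)
  have "0 \<le> variance (\<lambda>\<omega>. Y \<omega> + t * Z \<omega>)" by (rule variance_positive)
  also have "\<dots> = variance Y + 2 * t * (expectation (\<lambda>\<omega>. Y \<omega> * Z \<omega>) - expectation Y * expectation Z) +
      t\<^sup>2 * variance Z"
  proof -
    have "variance (\<lambda>\<omega>. Y \<omega> + t * Z \<omega>) =
        expectation (\<lambda>\<omega>. (Y \<omega> + t * Z \<omega>)\<^sup>2) - (expectation (\<lambda>\<omega>. Y \<omega> + t * Z \<omega>))\<^sup>2"
      by (rule variance_eq) (simp_all add: sq)
    then show ?thesis
      unfolding sq by (simp add: variance_eq) (simp add: power2_eq_square algebra_simps)
  qed
  finally show ?thesis .
qed

lemma integrable_of_nn_integral_finite: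
  fixes f :: "'w \<Rightarrow> real"
  assumes "f \<in> borel_measurable M" "\<And>\<omega>. \<omega> \<in> space M \<Longrightarrow> 0 \<le> f \<omega>"
    "(\<integral>\<^sup>+\<omega>. ennreal (f \<omega>) \<partial>M) < \<infinity>"
  shows "integrable M f" "(\<integral>\<^sup>+\<omega>. ennreal (f \<omega>) \<partial>M) = ennreal (integral\<^sup>L M f)" "0 \<le> integral\<^sup>L M f"
proof -
  show int: "integrable M f" using assms by (intro integrableI_nonneg AE_I2) auto
  show "(\<integral>\<^sup>+\<omega>. ennreal (f \<omega>) \<partial>M) = ennreal (integral\<^sup>L M f)"
    using assms by (intro nn_integral_eq_integral int AE_I2) auto
  show "0 \<le> integral\<^sup>L M f" using assms by (intro integral_nonneg_AE AE_I2) auto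
qed

lemma disk_process_count_measurable:
  assumes "disk_process L M X" "B \<in> sets borel" "B \<subseteq> ball 0 1"
  shows "num_points X B \<in> borel_measurable M"
  using assms sets_disk_measureI[of B L]
  by (simp add: disk_process_def determinantal_point_process_def simple_point_process_def
      sets_disk_measure)

lemma disk_process_finite:
  assumes "disk_process L M X" "B \<subseteq> ball 0 R" "R < 1" "\<omega> \<in> space M"
  shows "finite (X \<omega> \<inter> B)"
proof -
  have "\<forall>C. compact C \<longrightarrow> C \<subseteq> ball 0 1 \<longrightarrow> finite (X \<omega> \<inter> C)"
    using assms(1,4)
    by (simp add: disk_process_def determinantal_point_process_def simple_point_process_def)
  moreover have "cball (0::complex) R \<subseteq> ball 0 1" using assms(3) by auto
  ultimately have "finite (X \<omega> \<inter> cball 0 R)" by simp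
  then show ?thesis by (rule rev_finite_subset) (use assms(2) in auto)
qed

lemma disk_process_mean:
  assumes "disk_process L M X" "B \<in> sets borel" "B \<subseteq> ball 0 1"
  shows "(\<integral>\<^sup>+\<omega>. num_points X B \<omega> \<partial>M) = emeasure (disk_intensity L) B"
  unfolding disk_intensity_def
  by (rule determinantal_mean[OF assms(1)[unfolded disk_process_def]])
    (use assms in \<open>auto simp: sigma_finite_disk_measure disk_diagonal_measurable disk_kernel_diagonal\<close>)

lemma disk_process_correlation:
  assumes "disk_process L M X" "A \<in> sets (disk_measure L)" "B \<in> sets (disk_measure L)" "A \<inter> B = {}"
  shows "(\<integral>\<^sup>+\<omega>. num_points X A \<omega> * num_points X B \<omega> \<partial>M) +
      (\<integral>\<^sup>+x. (\<integral>\<^sup>+y. ennreal (disk_kernel_sq L x y) * indicator B y \<partial>disk_measure L) * indicator A x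
        \<partial>disk_measure L) =
      (\<integral>\<^sup>+\<omega>. num_points X A \<omega> \<partial>M) * (\<integral>\<^sup>+\<omega>. num_points X B \<omega> \<partial>M)"
  by (rule determinantal_disjoint_correlation[OF assms(1)[unfolded disk_process_def]])
    (use assms in \<open>auto simp: sigma_finite_disk_measure disk_diagonal_measurable
      disk_kernel_diagonal disk_kernel_sq_measurable disk_kernel_mult_swap
      disk_diagonal_nonneg disk_kernel_sq_nonneg\<close>)

lemma disk_process_second_moment:
  assumes X: "disk_process L M X" and B: "B \<in> sets borel" "B \<subseteq> ball 0 R" and R: "R < 1"
  shows "(\<integral>\<^sup>+\<omega>. (num_points X B \<omega>)\<^sup>2 \<partial>M) \<le>
    (\<integral>\<^sup>+\<omega>. num_points X B \<omega> \<partial>M) + (\<integral>\<^sup>+\<omega>. num_points X B \<omega> \<partial>M)\<^sup>2"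
proof (rule second_moment_le_of_negative_correlation)
  show "simple_point_process M (ball 0 1) X"
    using X by (simp add: disk_process_def determinantal_point_process_def)
  show "B \<in> sets (restrict_space borel (ball 0 1))"
    using sets_disk_measureI[of B L] B(1) order_trans[OF B(2) subset_ball[of R 1 0]] R
    by (simp add: sets_disk_measure)
  show "finite (X \<omega> \<inter> B)" if "\<omega> \<in> space M" for \<omega>
    using disk_process_finite[OF X B(2) R that] .
  show "(\<integral>\<^sup>+\<omega>. num_points X C \<omega> * num_points X D \<omega> \<partial>M) \<le>
      (\<integral>\<^sup>+\<omega>. num_points X C \<omega> \<partial>M) * (\<integral>\<^sup>+\<omega>. num_points X D \<omega> \<partial>M)"
    if "C \<in> sets (restrict_space borel (ball 0 1))" "D \<in> sets (restrict_space borel (ball 0 1))"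
      "C \<inter> D = {}" for C D
    using that by (subst disk_process_correlation[OF X, symmetric]) (simp_all add: sets_disk_measure)
qed

lemma disk_process_count_moments:
  assumes X: "disk_process L M X" and L: "L > 0" and s: "s > 0"
    and B: "B \<in> sets borel" "B \<subseteq> ball 0 (1 - s)"
  defines "N \<equiv> (\<lambda>\<omega>. real (card (X \<omega> \<inter> B)))"
  shows "N \<in> borel_measurable M" "integrable M N" "integrable M (\<lambda>\<omega>. (N \<omega>)\<^sup>2)"
    "(\<integral>\<^sup>+\<omega>. num_points X B \<omega> \<partial>M) = ennreal (integral\<^sup>L M N)"
    "integral\<^sup>L M N \<ge> 0"
    "prob_space.variance M N \<le> 4 * L / s"
proof -
  interpret prob_space M
    using X by (simp add: disk_process_def determinantal_point_process_def simple_point_process_def)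
  have B1: "B \<subseteq> ball 0 1" using B(2) s by auto
  have N_eq: "num_points X B \<omega> = ennreal (N \<omega>)" if "\<omega> \<in> space M" for \<omega>
    unfolding N_def by (intro num_points_eq_card disk_process_finite[OF X B(2) _ that]) (use s in auto)
  have "(\<lambda>\<omega>. enn2real (num_points X B \<omega>)) \<in> borel_measurable M"
    using disk_process_count_measurable[OF X B(1) B1] by measurable
  then show meas [measurable]: "N \<in> borel_measurable M"
    by (rule measurable_cong[THEN iffD1, rotated]) (auto simp: N_eq N_def)
  have EN: "(\<integral>\<^sup>+\<omega>. num_points X B \<omega> \<partial>M) = (\<integral>\<^sup>+\<omega>. ennreal (N \<omega>) \<partial>M)"
    by (intro nn_integral_cong) (simp add: N_eq)
  have EN2: "(\<integral>\<^sup>+\<omega>. (num_points X B \<omega>)\<^sup>2 \<partial>M) = (\<integral>\<^sup>+\<omega>. ennreal ((N \<omega>)\<^sup>2) \<partial>M)"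
    by (intro nn_integral_cong) (simp add: N_eq N_def ennreal_power)
  have "(\<integral>\<^sup>+\<omega>. num_points X B \<omega> \<partial>M) \<le> emeasure (disk_intensity L) (ball 0 (1 - s))"
    unfolding disk_process_mean[OF X B(1) B1] using sets_disk_measureI[of "ball 0 (1 - s)" L] s B(2)
    by (intro emeasure_mono) (auto simp: disk_intensity_def)
  also have "\<dots> \<le> ennreal (4 * L / s)" by (rule emeasure_disk_intensity_ball[OF L s])
  finally have le: "(\<integral>\<^sup>+\<omega>. ennreal (N \<omega>) \<partial>M) \<le> ennreal (4 * L / s)" unfolding EN .
  have int: "integrable M N" "(\<integral>\<^sup>+\<omega>. ennreal (N \<omega>) \<partial>M) = ennreal (expectation N)" "0 \<le> expectation N"
    using integrable_of_nn_integral_finite[OF meas _ le_less_trans[OF le]] by (simp_all add: N_def)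
  then show "integrable M N" "(\<integral>\<^sup>+\<omega>. num_points X B \<omega> \<partial>M) = ennreal (expectation N)" "expectation N \<ge> 0"
    using EN by simp_all
  have sq_le: "(\<integral>\<^sup>+\<omega>. ennreal ((N \<omega>)\<^sup>2) \<partial>M) \<le> ennreal (expectation N + (expectation N)\<^sup>2)"
    using disk_process_second_moment[OF X B] s int(3)
    unfolding EN EN2 int(2) by (simp add: ennreal_power)
  have fin: "(\<integral>\<^sup>+\<omega>. ennreal ((N \<omega>)\<^sup>2) \<partial>M) < \<infinity>" using sq_le by (rule le_less_trans) simp
  show int2: "integrable M (\<lambda>\<omega>. (N \<omega>)\<^sup>2)"
    by (rule integrable_of_nn_integral_finite[OF _ _ fin]) auto
  have "(\<integral>\<^sup>+\<omega>. ennreal ((N \<omega>)\<^sup>2) \<partial>M) = ennreal (expectation (\<lambda>\<omega>. (N \<omega>)\<^sup>2))"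
    by (rule integrable_of_nn_integral_finite[OF _ _ fin]) auto
  then have "expectation (\<lambda>\<omega>. (N \<omega>)\<^sup>2) \<le> expectation N + (expectation N)\<^sup>2"
    using sq_le int(3) by (simp add: ennreal_le_iff del: ennreal_plus)
  moreover have "expectation N \<le> 4 * L / s"
    using le L s unfolding int(2) by (simp add: ennreal_le_iff)
  ultimately show "variance N \<le> 4 * L / s"
    by (simp add: variance_eq[OF int(1) int2])
qed

text \<open>
  The lower bound is a Cauchy--Schwarz argument in quadratic form: with \<open>Y\<close> the count in the ball of
  radius \<open>1 - s\<close> and \<open>Z\<close> the count in the annulus around it, the variance of \<open>Y + t * Z\<close> is
  nonnegative, \<open>Y\<close> and \<open>Z\<close> have covariance at most \<open>- (c / s)\<close> with the
  constant \<open>c\<close> of \<open>disk_covariance_ge\<close>, and the variance of \<open>Z\<close> is at most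
  \<open>8 * L / s\<close>.
\<close>

lemma disk_process_variance_bounds:
  assumes X: "disk_process L M X" and L: "L > 0" and s: "0 < s" "s \<le> 1 / 4"
  shows "s * count_variance M X (1 - s) \<le> 4 * L"
    and "(L\<^sup>2 / 4096 * (1 / 12) powr (2 * (L + 1)))\<^sup>2 / (8 * L) \<le> s * count_variance M X (1 - s)"
proof -
  interpret prob_space M
    using X by (simp add: disk_process_def determinantal_point_process_def simple_point_process_def)
  define D where "D = ball (0::complex) (1 - s)"
  define A where "A = ball (0::complex) (1 - s / 2) - ball 0 (1 - s)"
  define Y where "Y \<omega> = real (card (X \<omega> \<inter> D))" for \<omega>
  define Z where "Z \<omega> = real (card (X \<omega> \<inter> A))" for \<omega>
  have Dp: "D \<in> sets borel" "D \<subseteq> ball 0 (1 - s)" by (auto simp: D_def)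
  have Ap: "A \<in> sets borel" "A \<subseteq> ball 0 (1 - s / 2)" by (auto simp: A_def)
  have s2: "s / 2 > 0" using s by simp
  note Ym = disk_process_count_moments[OF X L s(1) Dp, folded Y_def]
  note Zm = disk_process_count_moments[OF X L s2 Ap, folded Z_def]
  note [measurable] = Ym(1) Zm(1)
  have var: "count_variance M X (1 - s) = variance Y"
    unfolding count_variance_def Y_def[abs_def] D_def by (rule refl)
  show "s * count_variance M X (1 - s) \<le> 4 * L"
    using Ym(6) s by (simp add: var field_simps)
  define c where "c = L\<^sup>2 / 4096 * (1 / 12) powr (2 * (L + 1))"
  have c: "c \<ge> 0" by (simp add: c_def)
  have YZ: "num_points X D \<omega> * num_points X A \<omega> = ennreal (Y \<omega> * Z \<omega>)" if \<omega>: "\<omega> \<in> space M" for \<omega>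
  proof -
    have "finite (X \<omega> \<inter> D)" "finite (X \<omega> \<inter> A)"
      using disk_process_finite[OF X Dp(2) _ \<omega>] disk_process_finite[OF X Ap(2) _ \<omega>] s by auto
    then show ?thesis by (simp add: num_points_eq_card[of X \<omega>] Y_def Z_def ennreal_mult)
  qed
  have "D \<in> sets (disk_measure L)" "A \<in> sets (disk_measure L)"
    using Dp Ap s by (auto intro!: sets_disk_measureI simp: D_def A_def)
  then have "(\<integral>\<^sup>+\<omega>. num_points X D \<omega> * num_points X A \<omega> \<partial>M) +
      (\<integral>\<^sup>+x. (\<integral>\<^sup>+y. ennreal (disk_kernel_sq L x y) * indicator A y \<partial>disk_measure L) * indicator D x
        \<partial>disk_measure L) = ennreal (expectation Y) * ennreal (expectation Z)"
    unfolding Ym(4)[symmetric] Zm(4)[symmetric]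
    by (intro disk_process_correlation[OF X]) (auto simp: D_def A_def)
  moreover have "(\<integral>\<^sup>+\<omega>. num_points X D \<omega> * num_points X A \<omega> \<partial>M) = (\<integral>\<^sup>+\<omega>. ennreal (Y \<omega> * Z \<omega>) \<partial>M)"
    by (intro nn_integral_cong) (simp add: YZ)
  ultimately have eq: "(\<integral>\<^sup>+\<omega>. ennreal (Y \<omega> * Z \<omega>) \<partial>M) +
      (\<integral>\<^sup>+x. (\<integral>\<^sup>+y. ennreal (disk_kernel_sq L x y) * indicator A y \<partial>disk_measure L) * indicator D x
        \<partial>disk_measure L) = ennreal (expectation Y * expectation Z)"
    using Ym(5) Zm(5) by (simp add: ennreal_mult)
  have cov: "(\<integral>\<^sup>+\<omega>. ennreal (Y \<omega> * Z \<omega>) \<partial>M) + ennreal (c / s) \<le>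
      ennreal (expectation Y * expectation Z)"
    unfolding eq[symmetric] c_def D_def A_def by (intro add_left_mono disk_covariance_ge L s)
  have "(\<integral>\<^sup>+\<omega>. ennreal (Y \<omega> * Z \<omega>) \<partial>M) \<le> (\<integral>\<^sup>+\<omega>. ennreal (Y \<omega> * Z \<omega>) \<partial>M) + ennreal (c / s)"
    by simp
  also note cov
  finally have fin: "(\<integral>\<^sup>+\<omega>. ennreal (Y \<omega> * Z \<omega>) \<partial>M) < \<infinity>"
    by (rule le_less_trans) simp
  have YZ0: "0 \<le> Y \<omega> * Z \<omega>" for \<omega> by (simp add: Y_def Z_def)
  note YZi = integrable_of_nn_integral_finite[OF _ YZ0 fin]
  have YZm: "(\<lambda>\<omega>. Y \<omega> * Z \<omega>) \<in> borel_measurable M" by measurable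
  have "ennreal (expectation (\<lambda>\<omega>. Y \<omega> * Z \<omega>) + c / s) \<le> ennreal (expectation Y * expectation Z)"
    using cov YZi(3)[OF YZm] c s unfolding YZi(2)[OF YZm] by simp
  then have cov': "expectation (\<lambda>\<omega>. Y \<omega> * Z \<omega>) - expectation Y * expectation Z \<le> - (c / s)"
    using Ym(5) Zm(5) by (subst (asm) ennreal_le_iff) auto
  \<comment> \<open>the value of \<open>t\<close> that minimises \<open>- 2 * t * c / s + t\<^sup>2 * (8 * L / s)\<close>\<close>
  define t where "t = c / (8 * L)"
  have t: "t \<ge> 0" using c L by (simp add: t_def)
  have "0 \<le> variance Y + 2 * t * (expectation (\<lambda>\<omega>. Y \<omega> * Z \<omega>) - expectation Y * expectation Z) +
      t\<^sup>2 * variance Z"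
    by (intro variance_add_scaled_nonneg Ym(2,3) Zm(2,3) YZi(1)[OF YZm])
  also have "\<dots> \<le> variance Y + 2 * t * (- (c / s)) + t\<^sup>2 * (8 * L / s)"
    using Zm(6) by (intro add_mono mult_left_mono cov' order_refl) (use t in auto)
  also have "\<dots> = variance Y - c\<^sup>2 / (8 * L) / s"
    unfolding t_def using L s by (simp add: field_simps power2_eq_square)
  finally have "c\<^sup>2 / (8 * L) / s \<le> variance Y" by simp
  then have "c\<^sup>2 / (8 * L) \<le> s * variance Y"
    unfolding pos_divide_le_eq[OF s(1)] by (simp only: mult.commute)
  then show "(L\<^sup>2 / 4096 * (1 / 12) powr (2 * (L + 1)))\<^sup>2 / (8 * L) \<le> s * count_variance M X (1 - s)"
    unfolding var c_def .
qed

theorem theorem6p3: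
  fixes L :: real
  assumes "L > 0"
  shows "(\<forall>(M :: 'w measure) X. disk_process L M X \<longrightarrow>
           count_variance M X \<in> \<Theta>[at_left 1](\<lambda>r. 1 / (1 - r))) \<and>
         (\<exists>c1>0. \<exists>c2>0. \<forall>\<^sub>F r in at_left 1.
           \<forall>(M :: 'w measure) X. disk_process L M X \<longrightarrow>
             c2 \<le> (1 - r) * count_variance M X r \<and> (1 - r) * count_variance M X r \<le> c1)"
proof -
  define c2 where "c2 = (L\<^sup>2 / 4096 * (1 / 12) powr (2 * (L + 1)))\<^sup>2 / (8 * L)"
  have c2: "c2 > 0" using assms by (simp add: c2_def)
  have near: "\<forall>\<^sub>F r in at_left (1::real). 3 / 4 < r \<and> r < 1"
    by (rule eventually_at_leftI[of "3 / 4"]) auto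
  have bounds: "c2 \<le> (1 - r) * count_variance M X r \<and> (1 - r) * count_variance M X r \<le> 4 * L"
    if "disk_process L M X" "3 / 4 < r \<and> r < 1" for r and M :: "'w measure" and X
    using disk_process_variance_bounds[OF that(1) assms, of "1 - r"] that(2) by (simp add: c2_def)
  have "count_variance M X \<in> \<Theta>[at_left 1](\<lambda>r. 1 / (1 - r))"
    if X: "disk_process L M X" for M :: "'w measure" and X
  proof (rule bigthetaI)
    show "count_variance M X \<in> O[at_left 1](\<lambda>r. 1 / (1 - r))"
    proof (rule bigoI[of _ "4 * L"], use near in eventually_elim)
      case (elim r)
      have "0 \<le> (1 - r) * count_variance M X r" using bounds[OF X elim] c2 by linarith
      then have "0 \<le> count_variance M X r" using elim by (simp add: zero_le_mult_iff)
      then show ?case using bounds[OF X elim] elim by (simp add: field_simps)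
    qed
    show "count_variance M X \<in> \<Omega>[at_left 1](\<lambda>r. 1 / (1 - r))"
    proof (rule landau_omega.bigI[OF c2], use near in eventually_elim)
      case (elim r)
      have "c2 / (1 - r) \<le> count_variance M X r"
        using bounds[OF X elim] elim by (simp add: field_simps)
      also have "\<dots> \<le> \<bar>count_variance M X r\<bar>" by simp
      finally show ?case using elim by simp
    qed
  qed
  moreover have "\<forall>\<^sub>F r in at_left 1. \<forall>(M :: 'w measure) X. disk_process L M X \<longrightarrow>
      c2 \<le> (1 - r) * count_variance M X r \<and> (1 - r) * count_variance M X r \<le> 4 * L"
    using near by eventually_elim (use bounds in blast)
  ultimately show ?thesis using c2 assms by (intro conjI allI impI exI[of _ "4 * L"] exI[of _ c2]) auto
qed

end
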